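(* For all integers $a,m$ with $1\le a\le m-1$, the sequence $\{\mathrm{cp}_{a,m-a,m}(n)\}_{n=0}^\infty$ takes both even and odd values infinitely often.
   Context: For integers $a,b,m\ge1$, an $(a,b,m)$-copartition is a triple of integer partitions $(\gamma,\rho,\sigma)$ such that every part of $\gamma$ is $\ge a$ and $\equiv a \pmod m$, every part of $\sigma$ is $\ge b$ and $\equiv b\pmod m$, and $\rho$ has exactly as many parts as $\sigma$, each part of $\rho$ being equal to $m$ times the number of parts of $\gamma$. Its size is the sum of all parts of $\gamma,\rho,\sigma$, and $\mathrm{cp}_{a,b,m}(n)$ denotes the number of $(a,b,m)$-copartitions of size $n$. *)

theory Defs
  imports "HOL-Library.Multiset" "HOL-Number_Theory.Cong"
begin

text \<open>
  Partitions are finite multisets of natural numbers. For \<open>a, b \<ge> 1\<close> the parts of \<open>\<gamma>\<close> and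
  \<open>\<sigma>\<close> are automatically positive. Parts of \<open>\<rho>\<close> may be \<open>0\<close>: this happens exactly when \<open>\<gamma>\<close> is
  empty and \<open>\<sigma>\<close> is not, and such triples are copartitions (\<open>\<rho>\<close> then contributes nothing and is
  customarily regarded as empty). Since \<open>\<rho>\<close> is determined by \<open>\<gamma>\<close> and \<open>\<sigma>\<close>, no triple is
  counted twice.
\<close>

definition copartitions ::
    "nat \<Rightarrow> nat \<Rightarrow> nat \<Rightarrow> (nat multiset \<times> nat multiset \<times> nat multiset) set" where
  "copartitions a b m = {(\<gamma>, \<rho>, \<sigma>).
     (\<forall>x \<in># \<gamma>. x \<ge> a \<and> [x = a] (mod m)) \<and>
     (\<forall>x \<in># \<sigma>. x \<ge> b \<and> [x = b] (mod m)) \<and>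
     size \<rho> = size \<sigma> \<and>
     (\<forall>x \<in># \<rho>. x = m * size \<gamma>)}"

definition copartition_size :: "nat multiset \<times> nat multiset \<times> nat multiset \<Rightarrow> nat" where
  "copartition_size = (\<lambda>(\<gamma>, \<rho>, \<sigma>). \<Sum>\<^sub># \<gamma> + \<Sum>\<^sub># \<rho> + \<Sum>\<^sub># \<sigma>)"

definition cp :: "nat \<Rightarrow> nat \<Rightarrow> nat \<Rightarrow> nat \<Rightarrow> nat" where
  "cp a b m n = card {t \<in> copartitions a b m. copartition_size t = n}"

lemma size_le_sum_mset_pos:
  fixes M :: "nat multiset"
  assumes "\<forall>x \<in># M. 1 \<le> x"
  shows "size M \<le> \<Sum>\<^sub># M"
  using assms by (induction M) auto

lemma finite_copartitions_of_size:
  assumes "a \<ge> 1" "b \<ge> 1"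
  shows "finite {t \<in> copartitions a b m. copartition_size t = n}"
proof -
  define F where "F = mset ` {xs :: nat list. set xs \<subseteq> {..n} \<and> length xs \<le> n}"
  have "finite F"
    unfolding F_def by (intro finite_imageI finite_lists_length_le) auto
  have F: "M \<in> F" if "size M \<le> n" "\<Sum>\<^sub># M \<le> n" for M
  proof -
    obtain xs where xs: "M = mset xs"
      by (metis ex_mset)
    have "x \<le> n" if "x \<in># M" for x
      using sum_mset.remove[OF that] \<open>\<Sum>\<^sub># M \<le> n\<close> by simp
    with xs \<open>size M \<le> n\<close> show ?thesis
      unfolding F_def by auto
  qed
  have "{t \<in> copartitions a b m. copartition_size t = n} \<subseteq> F \<times> F \<times> F"
  proof (clarsimp simp: copartitions_def copartition_size_def, intro conjI)
    fix \<gamma> \<rho> \<sigma> :: "nat multiset"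
    assume *: "\<forall>x \<in># \<gamma>. a \<le> x \<and> [x = a] (mod m)" "\<forall>x \<in># \<sigma>. b \<le> x \<and> [x = b] (mod m)"
      "size \<rho> = size \<sigma>" "n = \<Sum>\<^sub># \<gamma> + \<Sum>\<^sub># \<rho> + \<Sum>\<^sub># \<sigma>"
    have "size \<gamma> \<le> \<Sum>\<^sub># \<gamma>" "size \<sigma> \<le> \<Sum>\<^sub># \<sigma>"
      using * assms by (auto intro!: size_le_sum_mset_pos)
    with * show "\<gamma> \<in> F" "\<rho> \<in> F" "\<sigma> \<in> F"
      by (auto intro!: F)
  qed
  with \<open>finite F\<close> show ?thesis
    by (meson finite_SigmaI finite_subset)
qed

end

theory Submission
  imports Defs "HOL-Computational_Algebra.Formal_Power_Series" "HOL-Library.Z2"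
begin

text \<open>
  Let \<open>F(a, b)\<close> be the generating function of \<open>cp a b m\<close>. Removing a smallest part \<open>a\<close> of \<open>\<gamma>\<close> gives
  \<open>F(a, b) = F(a + m, b) + X\<^sup>a F(a, b + m)\<close>; with the symmetry of \<open>F\<close> this yields
  \<open>(1 - X\<^sup>a) F(a, b) = (1 - X\<^bsup>a+b\<^esup>) F(a + m, b)\<close>, hence a product formula for \<open>F(a, m - a)\<close>.
  Modulo 2 the Jacobi triple product turns it into
  \<open>F(a, m - a) \<cdot> \<Sum>\<^sub>j X\<^bsup>m j(j-1)/2 + a j\<^esup> = \<Sum>\<^sub>j X\<^bsup>m j(3j-1)\<^esup>\<close> with \<open>j\<close> ranging over the integers.
  If \<open>2 a = m\<close>, the theta series on the left is 1 modulo 2 and the parities are explicit.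
  Otherwise the gaps between its exponents \<open>e\<^sub>j\<close> tend to infinity. If the coefficients of \<open>F\<close> were
  eventually constant modulo 2, then \<open>G = F\<close> or \<open>G = (1 + X) F\<close> would be a polynomial of some degree \<open>d\<close>,
  and for large \<open>\<bar>j\<bar>\<close> no cancellation could occur at \<open>e\<^sub>j + d\<close>; so \<open>e\<^sub>j + d\<close> would exceed some \<open>m i(3i-1)\<close>
  by 0 or 1. The latter numbers are too sparse for this.
\<close>

unbundle fps_syntax

text \<open>These rules turn sums and products of bits into bit operations, out of reach of the ring laws.\<close>

declare add_bit_eq_xor [simp del] mult_bit_eq_and [simp del]

section \<open>Copartition counts\<close>

definition cong_parts :: "nat \<Rightarrow> nat \<Rightarrow> nat multiset set" where
  "cong_parts a m = {\<gamma>. \<forall>x \<in># \<gamma>. x \<ge> a \<and> [x = a] (mod m)}"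

text \<open>The partition \<open>\<rho>\<close> is forced to consist of \<open>size \<sigma>\<close>
  copies of \<open>m * size \<gamma>\<close>, so only its sum is kept.\<close>

definition copartition_pairs :: "nat \<Rightarrow> nat \<Rightarrow> nat \<Rightarrow> nat \<Rightarrow> (nat multiset \<times> nat multiset) set" where
  "copartition_pairs a b m n = {(\<gamma>, \<sigma>). \<gamma> \<in> cong_parts a m \<and> \<sigma> \<in> cong_parts b m \<and>
     \<Sum>\<^sub># \<gamma> + \<Sum>\<^sub># \<sigma> + m * size \<gamma> * size \<sigma> = n}"

lemma bij_betw_copartition_pairs:
  "bij_betw (\<lambda>(\<gamma>, \<rho>, \<sigma>). (\<gamma>, \<sigma>)) {t \<in> copartitions a b m. copartition_size t = n}
     (copartition_pairs a b m n)"
proof -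
  have rho: "\<rho> = replicate_mset (size \<sigma>) c" if "size \<rho> = size \<sigma>" "\<forall>x\<in>#\<rho>. x = c"
    for \<rho> \<sigma> :: "nat multiset" and c
  proof -
    have "\<rho> = replicate_mset (size \<rho>) c"
      using that(2) by (metis set_mset_subset_singletonD singletonI subsetI)
    with that(1) show ?thesis by simp
  qed
  show ?thesis
    by (rule bij_betw_byWitness[where f' = "\<lambda>(\<gamma>, \<sigma>). (\<gamma>, replicate_mset (size \<sigma>) (m * size \<gamma>), \<sigma>)"])
      (auto simp: copartitions_def copartition_size_def copartition_pairs_def cong_parts_def
         algebra_simps dest!: rho split: if_splits)
qed

lemma cp_eq_card_pairs: "cp a b m n = card (copartition_pairs a b m n)"
  unfolding cp_def by (rule bij_betw_same_card[OF bij_betw_copartition_pairs])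

lemma finite_copartition_pairs:
  assumes "a \<ge> 1" "b \<ge> 1"
  shows "finite (copartition_pairs a b m n)"
  using bij_betw_finite[OF bij_betw_copartition_pairs] finite_copartitions_of_size[OF assms] by blast

lemma cp_commute: "cp a b m n = cp b a m n"
proof -
  have "bij_betw prod.swap (copartition_pairs a b m n) (copartition_pairs b a m n)"
    by (rule bij_betw_byWitness[where f' = prod.swap])
      (auto simp: copartition_pairs_def algebra_simps)
  then show ?thesis
    by (simp add: cp_eq_card_pairs bij_betw_same_card)
qed

lemma cong_parts_iff:
  assumes "m \<ge> 1"
  shows "\<gamma> \<in> cong_parts a m \<longleftrightarrow> (\<forall>x \<in># \<gamma>. \<exists>k. x = a + m * k)"
proof -
  have "x \<ge> a \<and> [x = a] (mod m) \<longleftrightarrow> (\<exists>k. x = a + m * k)" for x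
  proof
    assume *: "x \<ge> a \<and> [x = a] (mod m)"
    then have "m dvd x - a"
      by (metis cong_altdef_nat)
    then obtain k where "x - a = m * k" by blast
    with * show "\<exists>k. x = a + m * k" by (metis le_add_diff_inverse)
  qed (auto simp: cong_def)
  then show ?thesis by (simp add: cong_parts_def)
qed

lemma cong_parts_add_iff:
  assumes "m \<ge> 1"
  shows "\<gamma> \<in> cong_parts (a + m) m \<longleftrightarrow> \<gamma> \<in> cong_parts a m \<and> a \<notin># \<gamma>"
proof -
  have "(\<exists>k. x = a + m + m * k) \<longleftrightarrow> (\<exists>k. x = a + m * k) \<and> x \<noteq> a" for x
  proof safe
    fix k assume "a + m * k \<noteq> a"
    then obtain l where "k = Suc l" by (cases k) auto
    then show "\<exists>l. a + m * k = a + m + m * l" by auto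
  next
    fix k show "\<exists>l. a + m + m * k = a + m * l" by (rule exI[of _ "Suc k"]) simp
  qed (use assms in auto)
  then show ?thesis unfolding cong_parts_iff[OF assms] by blast
qed

lemma sum_image_mset_add: "\<Sum>\<^sub># (image_mset (\<lambda>x. x + m) M) = \<Sum>\<^sub># M + m * size M" for m :: nat
  by (induction M) auto

lemma image_mset_add_in_cong_parts:
  assumes "m \<ge> 1" "\<sigma> \<in> cong_parts b m"
  shows "image_mset (\<lambda>x. x + m) \<sigma> \<in> cong_parts (b + m) m"
  using assms(2) unfolding cong_parts_iff[OF assms(1)] by force

lemma image_mset_diff_in_cong_parts:
  assumes "m \<ge> 1" "\<sigma> \<in> cong_parts (b + m) m"
  shows "image_mset (\<lambda>x. x - m) \<sigma> \<in> cong_parts b m"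
    and "image_mset (\<lambda>x. x + m) (image_mset (\<lambda>x. x - m) \<sigma>) = \<sigma>"
proof -
  show "image_mset (\<lambda>x. x - m) \<sigma> \<in> cong_parts b m"
    using assms(2) unfolding cong_parts_iff[OF assms(1)] by force
  have "image_mset (\<lambda>x. x - m + m) \<sigma> = image_mset (\<lambda>x. x) \<sigma>"
    using assms(2) unfolding cong_parts_iff[OF assms(1)] by (intro image_mset_cong) auto
  then show "image_mset (\<lambda>x. x + m) (image_mset (\<lambda>x. x - m) \<sigma>) = \<sigma>"
    by (simp add: multiset.map_comp o_def)
qed

text \<open>
  Removing a part \<open>a\<close> from \<open>\<gamma>\<close> shrinks \<open>\<rho>\<close> by \<open>m\<close> for each part of \<open>\<sigma>\<close>; adding \<open>m\<close> to
  every part of \<open>\<sigma>\<close> compensates for this, so the total size drops by exactly \<open>a\<close>.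
\<close>

lemma bij_betw_remove_least_part:
  assumes m: "m \<ge> 1" and "a \<le> n"
  shows "bij_betw (\<lambda>(\<gamma>, \<sigma>). (\<gamma> - {#a#}, image_mset (\<lambda>x. x + m) \<sigma>))
    {(\<gamma>, \<sigma>) \<in> copartition_pairs a b m n. a \<in># \<gamma>} (copartition_pairs a (b + m) m (n - a))"
    (is "bij_betw ?f ?A ?B")
proof (rule bij_betw_byWitness[where f' = "\<lambda>(\<gamma>, \<sigma>). (add_mset a \<gamma>, image_mset (\<lambda>x. x - m) \<sigma>)"])
  let ?g = "\<lambda>(\<gamma>, \<sigma>). (add_mset a \<gamma>, image_mset (\<lambda>x. x - m) \<sigma>)"
  show "\<forall>p \<in> ?A. ?g (?f p) = p"
    by (auto simp: multiset.map_comp o_def)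
  show "\<forall>p \<in> ?B. ?f (?g p) = p"
    using image_mset_diff_in_cong_parts(2)[OF m] by (auto simp: copartition_pairs_def)
  show "?f ` ?A \<subseteq> ?B"
  proof clarify
    fix \<gamma> \<sigma> assume "(\<gamma>, \<sigma>) \<in> copartition_pairs a b m n" "a \<in># \<gamma>"
    then obtain \<gamma>' where g: "\<gamma> = add_mset a \<gamma>'" by (meson mset_add)
    show "(\<gamma> - {#a#}, image_mset (\<lambda>x. x + m) \<sigma>) \<in> copartition_pairs a (b + m) m (n - a)"
      using \<open>(\<gamma>, \<sigma>) \<in> _\<close> image_mset_add_in_cong_parts[OF m, of \<sigma> b]
      by (auto simp: copartition_pairs_def sum_image_mset_add g algebra_simps cong_parts_def)
  qed
  show "?g ` ?B \<subseteq> ?A"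
  proof clarify
    fix \<gamma> \<sigma> assume *: "(\<gamma>, \<sigma>) \<in> ?B"
    define \<tau> where "\<tau> = image_mset (\<lambda>x. x - m) \<sigma>"
    have s: "\<sigma> = image_mset (\<lambda>x. x + m) \<tau>" and t: "\<tau> \<in> cong_parts b m"
      using * image_mset_diff_in_cong_parts[OF m, of \<sigma> b]
      by (auto simp: copartition_pairs_def \<tau>_def)
    show "(add_mset a \<gamma>, image_mset (\<lambda>x. x - m) \<sigma>) \<in> copartition_pairs a b m n \<and> a \<in># add_mset a \<gamma>"
      using * t \<open>a \<le> n\<close> unfolding \<tau>_def[symmetric]
      by (auto simp: copartition_pairs_def s sum_image_mset_add algebra_simps cong_parts_def)
  qed
qed

lemma cp_rec:
  assumes m: "m \<ge> 1" and "a \<ge> 1" "b \<ge> 1"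
  shows "cp a b m n = cp (a + m) b m n + (if a \<le> n then cp a (b + m) m (n - a) else 0)"
proof -
  let ?P = "copartition_pairs a b m n"
  let ?A = "{(\<gamma>, \<sigma>) \<in> ?P. a \<in># \<gamma>}" and ?B = "{(\<gamma>, \<sigma>) \<in> ?P. a \<notin># \<gamma>}"
  have "?P = ?B \<union> ?A" "?B \<inter> ?A = {}" by auto
  moreover have "finite ?P" by (rule finite_copartition_pairs[OF assms(2,3)])
  ultimately have "card ?P = card ?B + card ?A"
    using card_Un_disjoint[of ?B ?A] finite_subset[of ?A ?P] finite_subset[of ?B ?P] by auto
  moreover have "?B = copartition_pairs (a + m) b m n"
    by (auto simp: copartition_pairs_def cong_parts_add_iff[OF m])
  moreover have "card ?A = (if a \<le> n then cp a (b + m) m (n - a) else 0)"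
  proof (cases "a \<le> n")
    case True
    then show ?thesis
      using bij_betw_same_card[OF bij_betw_remove_least_part[OF m True]] by (simp add: cp_eq_card_pairs)
  next
    case False
    then have "?A = {}"
      by (auto simp: copartition_pairs_def dest!: multi_member_split)
    with False show ?thesis by (metis card.empty)
  qed
  ultimately show ?thesis by (simp add: cp_eq_card_pairs)
qed

text \<open>A nonempty \<open>\<gamma>\<close> or \<open>\<sigma>\<close> already has sum above
  \<open>n\<close>. Hence the generating function tends to 1 as \<open>a\<close> and
  \<open>b\<close> grow.\<close>

lemma cp_eq_of_bool:
  assumes "n < a" "n < b"
  shows "cp a b m n = of_bool (n = 0)"
proof -
  have empty: "\<gamma> = {#}" if "\<gamma> \<in> cong_parts c m" "\<Sum>\<^sub># \<gamma> \<le> n" "n < c" for \<gamma> c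
  proof (rule ccontr)
    assume "\<gamma> \<noteq> {#}"
    then obtain x \<delta> where "\<gamma> = add_mset x \<delta>" by (meson multiset_cases)
    with that show False by (auto simp: cong_parts_def)
  qed
  have "p \<in> copartition_pairs a b m n \<longleftrightarrow> n = 0 \<and> p = ({#}, {#})" for p
  proof
    assume "p \<in> copartition_pairs a b m n"
    moreover obtain \<gamma> \<sigma> where p: "p = (\<gamma>, \<sigma>)" by fastforce
    ultimately have "\<gamma> \<in> cong_parts a m" "\<sigma> \<in> cong_parts b m"
      and n: "\<Sum>\<^sub># \<gamma> + \<Sum>\<^sub># \<sigma> + m * size \<gamma> * size \<sigma> = n"
      by (auto simp: copartition_pairs_def)
    with assms have "\<gamma> = {#}" "\<sigma> = {#}" by (auto intro!: empty)
    with n p show "n = 0 \<and> p = ({#}, {#})" by simp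
  qed (auto simp: copartition_pairs_def cong_parts_def)
  then have "copartition_pairs a b m n = (if n = 0 then {({#}, {#})} else {})"
    by auto
  then show ?thesis by (simp add: cp_eq_card_pairs)
qed

section \<open>Generating functions over the two-element field and their product formula\<close>

definition cp_fps :: "nat \<Rightarrow> nat \<Rightarrow> nat \<Rightarrow> bit fps" where
  "cp_fps a b m = Abs_fps (\<lambda>n. of_nat (cp a b m n))"

lemma cp_fps_nth: "cp_fps a b m $ n = of_nat (cp a b m n)"
  by (simp add: cp_fps_def)

lemma cp_fps_commute: "cp_fps a b m = cp_fps b a m"
  by (rule fps_ext) (simp add: cp_fps_nth cp_commute)

lemma cp_fps_rec:
  assumes "m \<ge> 1" "a \<ge> 1" "b \<ge> 1"
  shows "cp_fps a b m = cp_fps (a + m) b m + fps_X ^ a * cp_fps a (b + m) m"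
  by (rule fps_ext) (auto simp: cp_fps_nth fps_X_power_mult_nth cp_rec[OF assms])

text \<open>Combining the recurrence for \<open>\<gamma>\<close> with its mirror image for \<open>\<sigma>\<close> eliminates \<open>cp_fps a (b + m) m\<close>.\<close>

lemma cp_fps_shift:
  assumes "m \<ge> 1" "a \<ge> 1" "b \<ge> 1"
  shows "cp_fps a b m * (1 - fps_X ^ a) = cp_fps (a + m) b m * (1 - fps_X ^ (a + b))"
proof -
  have eq: "cp_fps a b m = cp_fps a (b + m) m + fps_X ^ b * cp_fps (a + m) b m"
    using cp_fps_rec[OF assms(1,3,2)]
    unfolding cp_fps_commute[of b a m] cp_fps_commute[of "b + m" a m] cp_fps_commute[of b "a + m" m] .
  show ?thesis
    using arg_cong2[where f = "\<lambda>u v. u - fps_X ^ a * v", OF cp_fps_rec[OF assms] eq]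
    by (simp add: algebra_simps power_add)
qed

text \<open>The finite q-Pochhammer product (X^a; X^m)_N, reduced modulo 2.\<close>

definition qpoch :: "nat \<Rightarrow> nat \<Rightarrow> nat \<Rightarrow> bit fps" where
  "qpoch a m N = (\<Prod>k<N. 1 - fps_X ^ (a + m * k))"

lemma qpoch_Suc: "qpoch a m (Suc N) = qpoch a m N * (1 - fps_X ^ (a + m * N))"
  by (simp add: qpoch_def)

text \<open>This is \<open>cp_fps_shift\<close> iterated \<open>N\<close> times, with the
  denominators multiplied out.\<close>

lemma cp_fps_times_qpoch:
  assumes "m \<ge> 1" "a \<ge> 1" "b \<ge> 1"
  shows "cp_fps a b m * qpoch a m N = cp_fps (a + m * N) b m * qpoch (a + b) m N"
proof (induction N)
  case (Suc N)
  have "cp_fps a b m * qpoch a m (Suc N) =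
      cp_fps (a + m * N) b m * (1 - fps_X ^ (a + m * N)) * qpoch (a + b) m N"
    by (simp only: qpoch_Suc mult.assoc[symmetric] Suc) (simp only: mult_ac)
  also have "cp_fps (a + m * N) b m * (1 - fps_X ^ (a + m * N)) =
      cp_fps (a + m * N + m) b m * (1 - fps_X ^ (a + m * N + b))"
    using assms by (intro cp_fps_shift) auto
  also have "\<dots> * qpoch (a + b) m N = cp_fps (a + m * Suc N) b m * qpoch (a + b) m (Suc N)"
    by (simp add: qpoch_Suc ac_simps)
  finally show ?case .
qed (simp add: qpoch_def)

lemma prod_lessThan_add:
  "(\<Prod>k<M + N. f k) = (\<Prod>k<M. f k) * (\<Prod>k<N. f (M + k))" for f :: "nat \<Rightarrow> 'a::comm_monoid_mult"
  by (induction N) (simp_all add: mult.assoc)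

lemma qpoch_add: "qpoch a m (M + N) = qpoch a m M * qpoch (a + m * M) m N"
  unfolding qpoch_def prod_lessThan_add by (simp add: algebra_simps)

text \<open>First \<open>a\<close> is raised by \<open>m * N\<close>, then, after a swap of the
  arguments, \<open>m - a\<close>. The argument sum is \<open>m\<close> at the start of the first
  run and \<open>m + m * N\<close> at the start of the second, so the two products on the right
  concatenate.\<close>

lemma cp_fps_times_qpoch_qpoch:
  assumes "1 \<le> a" "a < m"
  shows "cp_fps a (m - a) m * (qpoch a m N * qpoch (m - a) m N) =
    cp_fps (a + m * N) (m - a + m * N) m * qpoch m m (2 * N)"
proof -
  let ?b = "m - a"
  have "cp_fps a ?b m * (qpoch a m N * qpoch ?b m N) =
      cp_fps (a + m * N) ?b m * qpoch ?b m N * qpoch m m N"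
  proof -
    have "cp_fps a ?b m * qpoch a m N = cp_fps (a + m * N) ?b m * qpoch m m N"
      using cp_fps_times_qpoch[of m a ?b N] assms by simp
    then show ?thesis by (simp only: mult.assoc[symmetric]) (simp only: mult_ac)
  qed
  also have "cp_fps (a + m * N) ?b m = cp_fps ?b (a + m * N) m"
    by (rule cp_fps_commute)
  also have "cp_fps ?b (a + m * N) m * qpoch ?b m N =
      cp_fps (?b + m * N) (a + m * N) m * qpoch (m + m * N) m N"
    using cp_fps_times_qpoch[of m ?b "a + m * N" N] assms by simp
  also have "cp_fps (?b + m * N) (a + m * N) m = cp_fps (a + m * N) (?b + m * N) m"
    by (rule cp_fps_commute)
  also have "\<dots> * qpoch (m + m * N) m N * qpoch m m N = \<dots> * qpoch m m (2 * N)"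
    unfolding mult_2[of N] qpoch_add by (simp only: mult_ac)
  finally show ?thesis .
qed

section \<open>Gaussian binomial coefficients\<close>

text \<open>The q-Pascal rule serves as definition, which avoids division and works in every
  commutative ring.\<close>

fun gauss_binomial :: "'a::comm_ring_1 \<Rightarrow> nat \<Rightarrow> nat \<Rightarrow> 'a" where
  "gauss_binomial q n 0 = 1"
| "gauss_binomial q 0 (Suc k) = 0"
| "gauss_binomial q (Suc n) (Suc k) = gauss_binomial q n k + q ^ Suc k * gauss_binomial q n (Suc k)"

lemma gauss_binomial_eq_0: "n < k \<Longrightarrow> gauss_binomial q n k = 0"
  by (induction q n k rule: gauss_binomial.induct) auto

text \<open>The quotient formula with denominators cleared. The induction rests on (1 - q^(k+1)) +
  q^(k+1) (1 - q^(n-k)) = 1 - q^(n+1).\<close>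

lemma gauss_binomial_mult_prods:
  "k \<le> n \<Longrightarrow> gauss_binomial q n k * (\<Prod>i<k. 1 - q ^ Suc i) * (\<Prod>i<n-k. 1 - q ^ Suc i) = (\<Prod>i<n. 1 - q ^ Suc i)"
proof (induction q n k rule: gauss_binomial.induct)
  case (3 q n k)
  let ?P = "\<lambda>n. \<Prod>i<n. 1 - q ^ Suc i"
  have "k \<le> n" using 3 by simp
  have 1: "gauss_binomial q n k * ?P (Suc k) * ?P (n - k) = (1 - q ^ Suc k) * ?P n"
  proof -
    have "gauss_binomial q n k * ?P (Suc k) * ?P (n - k) =
        (1 - q ^ Suc k) * (gauss_binomial q n k * ?P k * ?P (n - k))"
      by (simp add: mult_ac)
    with 3(1)[OF \<open>k \<le> n\<close>] show ?thesis by simp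
  qed
  have 2: "gauss_binomial q n (Suc k) * ?P (Suc k) * ?P (n - k) = (1 - q ^ (n - k)) * ?P n"
  \<comment> \<open>For \<open>k = n\<close> the induction hypothesis does not apply, but both sides
    vanish.\<close>
  proof (cases "k = n")
    case False
    with \<open>k \<le> n\<close> obtain d where d: "n - k = Suc d" "n - Suc k = d"
      by (metis Suc_diff_Suc le_neq_implies_less)
    have "gauss_binomial q n (Suc k) * ?P (Suc k) * ?P d = ?P n"
      using 3(2) \<open>k \<le> n\<close> False d by simp
    moreover have "gauss_binomial q n (Suc k) * ?P (Suc k) * ?P (Suc d) =
        (1 - q ^ Suc d) * (gauss_binomial q n (Suc k) * ?P (Suc k) * ?P d)"
      by (simp add: mult_ac)
    ultimately show ?thesis unfolding d by simp
  qed (simp add: gauss_binomial_eq_0)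
  have "gauss_binomial q (Suc n) (Suc k) * ?P (Suc k) * ?P (n - k) =
      gauss_binomial q n k * ?P (Suc k) * ?P (n - k) +
      q ^ Suc k * (gauss_binomial q n (Suc k) * ?P (Suc k) * ?P (n - k))"
    by (simp add: algebra_simps)
  also have "\<dots> = (1 - q ^ Suc k + (q ^ Suc k - q ^ Suc k * q ^ (n - k))) * ?P n"
    unfolding 1 2 by (simp only: algebra_simps mult_1_left)
  also have "q ^ Suc k * q ^ (n - k) = q ^ Suc n"
    using \<open>k \<le> n\<close> by (simp only: power_add[symmetric]) simp
  finally show ?case by simp
qed auto

text \<open>Splitting off the factor with \<open>k = 0\<close> turns \<open>x\<close> into
  \<open>x * q\<close> in the others, which matches the q-Pascal rule. The second variable
  \<open>y\<close> makes room for a positive power of \<open>q\<close> where the triple product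
  would need a negative one.\<close>

lemma gauss_binomial_theorem:
  fixes q x y :: "'a::comm_ring_1"
  shows "(\<Prod>k<n. y + x * q ^ k) =
    (\<Sum>k\<le>n. q ^ (k choose 2) * gauss_binomial q n k * x ^ k * y ^ (n - k))"
proof (induction n arbitrary: x)
  case (Suc n)
  let ?t = "\<lambda>n x k. q ^ (k choose 2) * gauss_binomial q n k * x ^ k * y ^ (n - k)"
  have "(\<Prod>k<Suc n. y + x * q ^ k) = (y + x) * (\<Prod>k<n. y + x * q * q ^ k)"
    by (simp only: prod.lessThan_Suc_shift) (simp add: mult_ac)
  also have "\<dots> = (y + x) * (\<Sum>k\<le>n. ?t n (x * q) k)"
    by (simp only: Suc)
  also have "\<dots> = (\<Sum>k\<le>n. y * ?t n (x * q) k) + (\<Sum>k\<le>n. x * ?t n (x * q) k)"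
    by (simp only: sum_distrib_left distrib_right[of y x] sum.distrib)
  also have "(\<Sum>k\<le>n. y * ?t n (x * q) k) = (\<Sum>k\<le>Suc n. y * ?t n (x * q) k)"
    by (simp add: gauss_binomial_eq_0)
  also have "\<dots> = y ^ Suc n + (\<Sum>k\<le>n. y * ?t n (x * q) (Suc k))"
    by (subst sum.atMost_Suc_shift) (simp add: numeral_2_eq_2)
  also have "\<dots> + (\<Sum>k\<le>n. x * ?t n (x * q) k) =
      y ^ Suc n + (\<Sum>k\<le>n. y * ?t n (x * q) (Suc k) + x * ?t n (x * q) k)"
    by (simp add: sum.distrib)
  also have "(\<Sum>k\<le>n. y * ?t n (x * q) (Suc k) + x * ?t n (x * q) k) = (\<Sum>k\<le>n. ?t (Suc n) x (Suc k))"
  proof (rule sum.cong[OF refl])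
    fix k assume "k \<in> {..n}"
    then have k: "k \<le> n" by simp
    have c: "Suc k choose 2 = (k choose 2) + k" by (simp add: numeral_2_eq_2)
    have 1: "y * ?t n (x * q) (Suc k) =
        q ^ (Suc k choose 2) * (q ^ Suc k * gauss_binomial q n (Suc k)) * x ^ Suc k * y ^ (n - k)"
    proof (cases "k = n")
      case False
      with k have "n - k = Suc (n - Suc k)" by simp
      then show ?thesis by (simp only: power_Suc power_mult_distrib mult_ac)
    qed (simp add: gauss_binomial_eq_0)
    have 2: "x * ?t n (x * q) k =
        q ^ (Suc k choose 2) * gauss_binomial q n k * x ^ Suc k * y ^ (n - k)"
      unfolding c by (simp add: power_mult_distrib power_add mult_ac)
    show "y * ?t n (x * q) (Suc k) + x * ?t n (x * q) k = ?t (Suc n) x (Suc k)"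
      unfolding 1 2 by (simp add: algebra_simps)
  qed
  also have "y ^ Suc n + \<dots> = (\<Sum>k\<le>Suc n. ?t (Suc n) x k)"
    by (subst sum.atMost_Suc_shift) (simp add: numeral_2_eq_2)
  finally show ?case .
qed (simp add: numeral_2_eq_2)

section \<open>Truncated equality of power series\<close>

text \<open>Congruence modulo \<open>fps_X ^ K\<close>. Infinite products are replaced by finite
  ones that are correct to growing precision.\<close>

definition fps_agree :: "nat \<Rightarrow> 'a fps \<Rightarrow> 'a fps \<Rightarrow> bool" where
  "fps_agree K f g \<longleftrightarrow> (\<forall>n<K. f $ n = g $ n)"

lemma fps_agree_refl [simp]: "fps_agree K f f"
  by (simp add: fps_agree_def)

lemma fps_agree_sym: "fps_agree K f g \<Longrightarrow> fps_agree K g f"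
  by (simp add: fps_agree_def)

lemma fps_agree_trans [trans]: "fps_agree K f g \<Longrightarrow> fps_agree K g h \<Longrightarrow> fps_agree K f h"
  by (simp add: fps_agree_def)

lemma fps_agree_mono: "fps_agree L f g \<Longrightarrow> K \<le> L \<Longrightarrow> fps_agree K f g"
  by (simp add: fps_agree_def)

lemma fps_agree_mult:
  fixes f g h k :: "'a::comm_ring_1 fps"
  shows "fps_agree K f g \<Longrightarrow> fps_agree K h k \<Longrightarrow> fps_agree K (f * h) (g * k)"
  by (auto simp: fps_agree_def fps_mult_nth intro!: sum.cong)

lemma fps_agree_sum:
  fixes f g :: "'b \<Rightarrow> 'a::comm_ring_1 fps"
  shows "(\<And>i. i \<in> A \<Longrightarrow> fps_agree K (f i) (g i)) \<Longrightarrow> fps_agree K (\<Sum>i\<in>A. f i) (\<Sum>i\<in>A. g i)"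
  by (auto simp: fps_agree_def fps_sum_nth intro!: sum.cong)

lemma fps_agree_X_power_mult:
  fixes f g :: "'a::comm_ring_1 fps"
  shows "fps_agree K f g \<Longrightarrow> fps_agree (k + K) (fps_X ^ k * f) (fps_X ^ k * g)"
  by (auto simp: fps_agree_def fps_X_power_mult_nth)

lemma fps_agree_mult_cancel:
  fixes f g u :: "'a::field fps"
  assumes "fps_agree K (u * f) (u * g)" "u $ 0 \<noteq> 0"
  shows "fps_agree K f g"
proof -
  have "fps_agree K (inverse u * (u * f)) (inverse u * (u * g))"
    by (rule fps_agree_mult[OF fps_agree_refl assms(1)])
  then show ?thesis
    by (simp add: mult.assoc[symmetric] inverse_mult_eq_1[OF assms(2)])
qed

lemma fps_eqI_agree: "(\<And>N. fps_agree N f g) \<Longrightarrow> f = g"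
  by (rule fps_ext) (auto simp: fps_agree_def)

lemma qpoch_nth_0: "a \<ge> 1 \<Longrightarrow> qpoch a m N $ 0 = 1"
  by (induction N) (auto simp: qpoch_def)

lemma qpoch_agree:
  assumes "N \<le> M"
  shows "fps_agree (a + m * N) (qpoch a m M) (qpoch a m N)"
  using assms
proof (induction M rule: dec_induct)
  case (step M)
  have "fps_agree (a + m * N) (1 - fps_X ^ (a + m * M) :: bit fps) 1"
    using step by (auto simp: fps_agree_def add_strict_mono)
  from fps_agree_mult[OF step.IH this] show ?case
    by (simp add: qpoch_Suc)
qed simp

lemma qpoch_eq_prod: "qpoch m m N = (\<Prod>i<N. 1 - (fps_X ^ m) ^ Suc i)"
  by (simp add: qpoch_def power_add power_mult)

text \<open>With r the minimum of \<open>k\<close> and \<open>2 * N - k\<close>, every product in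
  the quotient formula has at least r factors and so agrees with \<open>qpoch m m r\<close> up to
  order m (r + 1). The common unit then cancels.\<close>

lemma gauss_binomial_qpoch_agree:
  assumes "k \<le> 2 * N" "m \<ge> 1"
  shows "fps_agree (m * Suc (min k (2 * N - k)))
    (qpoch m m N * gauss_binomial (fps_X ^ m) (2 * N) k) 1"
proof -
  define r where "r = min k (2 * N - k)"
  define g :: "bit fps" where "g = gauss_binomial (fps_X ^ m) (2 * N) k"
  have Q: "fps_agree (m * Suc r) (qpoch m m i) (qpoch m m r)" if "r \<le> i" for i
    using qpoch_agree[OF that, of m m] by simp
  have r: "r \<le> k" "r \<le> 2 * N - k" "r \<le> N" "r \<le> 2 * N" using assms by (auto simp: r_def)
  have "g * qpoch m m k * qpoch m m (2 * N - k) = qpoch m m (2 * N)"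
    unfolding g_def qpoch_eq_prod by (rule gauss_binomial_mult_prods) fact
  then have "fps_agree (m * Suc r) (g * qpoch m m r * qpoch m m r) (qpoch m m r)"
    using fps_agree_mult[OF fps_agree_mult[OF fps_agree_refl[of _ g] fps_agree_sym[OF Q]] fps_agree_sym[OF Q],
        OF r(1,2)] fps_agree_trans[OF _ Q[OF r(4)]] by metis
  then have "fps_agree (m * Suc r) (qpoch m m r * (qpoch m m r * g)) (qpoch m m r * 1)"
    by (simp add: mult_ac)
  then have "fps_agree (m * Suc r) (qpoch m m r * g) 1"
    by (rule fps_agree_mult_cancel) (simp add: qpoch_nth_0[OF assms(2)])
  then show ?thesis
    unfolding r_def[symmetric] g_def[symmetric]
    using fps_agree_trans[OF fps_agree_mult[OF Q[OF r(3)] fps_agree_refl]] by blast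
qed

section \<open>The triple product modulo 2\<close>

text \<open>The exponent \<open>m j (j - 1) / 2 + a j\<close> is nonnegative for \<open>a \<le> m\<close>, so \<open>nat\<close> does not truncate.\<close>

definition theta_exp :: "nat \<Rightarrow> nat \<Rightarrow> int \<Rightarrow> nat" where
  "theta_exp m a j = nat (int m * (j * (j - 1) div 2) + int a * j)"

text \<open>Indices are counted with multiplicity because \<open>theta_exp\<close> is not always
  injective: for \<open>2 * a = m\<close> the indices \<open>j\<close> and \<open>-j\<close> share
  an exponent.\<close>

definition theta :: "nat \<Rightarrow> nat \<Rightarrow> bit fps" where
  "theta m a = Abs_fps (\<lambda>n. of_nat (card {j. theta_exp m a j = n}))"

text \<open>For negative \<open>j\<close> the linear term costs at most 2 m |j|, which lowers |j|
  (|j| + 1) to |j| (|j| - 1); for other \<open>j\<close> it only helps.\<close>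

lemma theta_exp_aux:
  assumes "a \<le> m"
  shows "int m * (\<bar>j\<bar> * (\<bar>j\<bar> - 1)) \<le> int m * (j * (j - 1)) + 2 * int a * j"
proof (cases "j \<ge> 0")
  case False
  then have "int a * (-j) \<le> int m * (-j)"
    using assms by (intro mult_right_mono) auto
  with False show ?thesis by (simp add: algebra_simps)
qed (use assms in simp)

lemma double_theta_exp:
  assumes "a \<le> m"
  shows "2 * int (theta_exp m a j) = int m * (j * (j - 1)) + 2 * int a * j"
proof -
  have "0 \<le> \<bar>j\<bar> * (\<bar>j\<bar> - 1)"
    by (cases "j = 0") auto
  then have "0 \<le> int m * (\<bar>j\<bar> * (\<bar>j\<bar> - 1))"
    by simp
  with theta_exp_aux[OF assms, of j] have nonneg: "0 \<le> int m * (j * (j - 1)) + 2 * int a * j"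
    by linarith
  have "2 * (j * (j - 1) div 2) = j * (j - 1)"
    by simp
  define E where "E = int m * (j * (j - 1) div 2) + int a * j"
  from \<open>2 * (j * (j - 1) div 2) = j * (j - 1)\<close>
  have "2 * E = int m * (j * (j - 1)) + 2 * int a * j"
    by (simp only: E_def distrib_left mult.left_commute[of 2] mult.assoc)
  moreover from this nonneg have "0 \<le> E"
    by linarith
  ultimately show ?thesis
    unfolding theta_exp_def E_def[symmetric] by simp
qed

lemma theta_exp_ge:
  assumes "a \<le> m"
  shows "int m * (\<bar>j\<bar> * (\<bar>j\<bar> - 1)) \<le> 2 * int (theta_exp m a j)"
  using theta_exp_aux[OF assms] double_theta_exp[OF assms] by simp

lemma theta_exp_large:
  assumes "a \<le> m" "int N < \<bar>j\<bar>"
  shows "m * N \<le> theta_exp m a j"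
proof (cases "N = 0")
  case False
  have "int N * 2 \<le> int N * (int N + 1)"
    using False by (intro mult_left_mono) auto
  also have "\<dots> \<le> (\<bar>j\<bar> - 1) * \<bar>j\<bar>"
    using assms(2) by (intro mult_mono) auto
  finally have "int m * (int N * 2) \<le> int m * (\<bar>j\<bar> * (\<bar>j\<bar> - 1))"
    by (intro mult_left_mono) (auto simp: mult.commute)
  also have "\<dots> \<le> 2 * int (theta_exp m a j)"
    by (rule theta_exp_ge) fact
  finally have "int (m * N) \<le> int (theta_exp m a j)" by simp
  then show ?thesis by linarith
qed simp

text \<open>The window \<open>k - N\<close> runs over all indices of absolute value at most
  \<open>N\<close>; the omitted ones have exponent at least \<open>m * N\<close> by
  \<open>theta_exp_large\<close>.\<close>

lemma theta_agree_sum: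
  assumes "a \<le> m"
  shows "fps_agree (m * N) (\<Sum>k\<le>2*N. fps_X ^ theta_exp m a (int k - int N)) (theta m a)"
  unfolding fps_agree_def
proof (intro allI impI)
  fix n assume n: "n < m * N"
  have "bij_betw (\<lambda>k. int k - int N) {k \<in> {..2*N}. theta_exp m a (int k - int N) = n} {j. theta_exp m a j = n}"
  proof (rule bij_betw_byWitness[where f' = "\<lambda>j. nat (j + int N)"])
    have "\<bar>j\<bar> \<le> int N" if "theta_exp m a j = n" for j
      using theta_exp_large[OF assms, of N j] that n by linarith
    then have N: "0 \<le> j + int N" "nat (j + int N) \<le> 2 * N" if "theta_exp m a j = n" for j
      using that by force+
    then show "(\<lambda>j. nat (j + int N)) ` {j. theta_exp m a j = n} \<subseteq> {k \<in> {..2*N}. theta_exp m a (int k - int N) = n}"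
      "\<forall>j\<in>{j. theta_exp m a j = n}. int (nat (j + int N)) - int N = j"
      by auto
  qed auto
  then have "card {k \<in> {..2*N}. theta_exp m a (int k - int N) = n} = card {j. theta_exp m a j = n}"
    by (rule bij_betw_same_card)
  moreover have "(\<Sum>k\<le>2*N. fps_X ^ theta_exp m a (int k - int N)) $ n =
      (of_nat (card {k \<in> {..2*N}. theta_exp m a (int k - int N) = n}) :: bit)"
    by (simp add: fps_sum_nth eq_commute[of n] flip: sum.inter_filter)
  ultimately show "(\<Sum>k\<le>2*N. fps_X ^ theta_exp m a (int k - int N)) $ n = theta m a $ n"
    by (simp add: theta_def)
qed

lemma bit_fps_minus: "f - g = f + g" for f g :: "bit fps"
  by (rule fps_ext) simp

lemma double_choose_two: "2 * int (k choose 2) = int k * (int k - 1)"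
proof -
  have "Suc k choose 2 = k + (k choose 2)" for k
    by (simp add: numeral_2_eq_2)
  then show ?thesis
    by (induction k) (simp_all add: algebra_simps)
qed

text \<open>The finite form of the Jacobi triple product; modulo 2 its alternating signs
  disappear.\<close>

lemma finite_triple_product:
  assumes "a \<le> m"
  shows "qpoch a m N * qpoch (m - a) m N =
    (\<Sum>k\<le>2*N. fps_X ^ theta_exp m a (int k - int N) * gauss_binomial (fps_X ^ m) (2 * N) k)"
proof -
  let ?X = "fps_X :: bit fps"
  \<comment> \<open>Put \<open>q = X\<^sup>m\<close>, \<open>x = X\<^sup>a\<close>, \<open>y = q\<^sup>N\<close> in the Gauss binomial theorem and cancel \<open>X\<^sup>c\<close>:
    this replaces \<open>x q\<^sup>-\<^sup>N\<close>, which is not a power series.\<close>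
  define c where "c = m * N * N + a * N + m * (N choose 2)"
  \<comment> \<open>In each factor the term of lower order is pulled out:
    \<open>X^(a + m * k)\<close> in this half, \<open>X^(m * N)\<close> in the other. What remains
    here is \<open>qpoch (m - a) m N\<close> in reverse order.\<close>
  have low: "(\<Prod>k<N. (?X ^ m) ^ N + ?X ^ a * (?X ^ m) ^ k) = ?X ^ (a * N + m * (N choose 2)) * qpoch (m - a) m N"
  proof -
    have "(\<Prod>k<N. (?X ^ m) ^ N + ?X ^ a * (?X ^ m) ^ k) =
        (\<Prod>k<N. ?X ^ (a + m * k) * (1 - ?X ^ (m - a + m * (N - Suc k))))"
    proof (rule prod.cong[OF refl])
      fix k assume "k \<in> {..<N}"
      then obtain d where "N = Suc (k + d)"
        using less_imp_Suc_add by auto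
      then have e: "m * N = a + m * k + (m - a + m * (N - Suc k))"
        using assms by (simp add: algebra_simps)
      show "(?X ^ m) ^ N + ?X ^ a * (?X ^ m) ^ k = ?X ^ (a + m * k) * (1 - ?X ^ (m - a + m * (N - Suc k)))"
        unfolding power_mult[symmetric] e bit_fps_minus by (simp add: distrib_left flip: power_add)
    qed
    also have "\<dots> = (\<Prod>k<N. ?X ^ (a + m * k)) * (\<Prod>k<N. 1 - ?X ^ (m - a + m * (N - Suc k)))"
      by (rule prod.distrib)
    also have "(\<Prod>k<N. 1 - ?X ^ (m - a + m * (N - Suc k))) = qpoch (m - a) m N"
      unfolding qpoch_def by (rule prod.nat_diff_reindex)
    also have "(\<Prod>k<N. ?X ^ (a + m * k)) = ?X ^ (a * N + m * (N choose 2))"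
      by (induction N) (simp_all add: numeral_2_eq_2 algebra_simps flip: power_add)
    finally show ?thesis .
  qed
  have high: "(\<Prod>k<N. (?X ^ m) ^ N + ?X ^ a * (?X ^ m) ^ (N + k)) = ?X ^ (m * N * N) * qpoch a m N"
  proof -
    have "(?X ^ m) ^ N + ?X ^ a * (?X ^ m) ^ (N + k) = ?X ^ (m * N) * (1 - ?X ^ (a + m * k))" for k
      unfolding bit_fps_minus
      by (simp add: distrib_left algebra_simps flip: power_mult power_add)
    then show ?thesis
      by (simp add: prod.distrib qpoch_def flip: power_mult)
  qed
  have "?X ^ c * (qpoch a m N * qpoch (m - a) m N) = (\<Prod>k<2*N. (?X ^ m) ^ N + ?X ^ a * (?X ^ m) ^ k)"
    unfolding mult_2 prod_lessThan_add low high c_def by (simp only: power_add mult_ac)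
  also have "\<dots> = (\<Sum>k\<le>2*N. (?X ^ m) ^ (k choose 2) * gauss_binomial (?X ^ m) (2*N) k * (?X ^ a) ^ k * ((?X ^ m) ^ N) ^ (2*N - k))"
    by (rule gauss_binomial_theorem)
  also have "\<dots> = (\<Sum>k\<le>2*N. ?X ^ c * (?X ^ theta_exp m a (int k - int N) * gauss_binomial (?X ^ m) (2*N) k))"
  proof (rule sum.cong[OF refl])
    fix k assume "k \<in> {..2*N}"
    then have k: "int (2 * N - k) = 2 * int N - int k" by auto
    \<comment> \<open>Doubling clears the halves in the binomial coefficients and in
      \<open>theta_exp\<close>, so the exponents can be compared as integer polynomials.\<close>
    have "2 * int (m * (k choose 2) + a * k + m * N * (2*N - k)) = 2 * int (c + theta_exp m a (int k - int N))"
      unfolding c_def of_nat_add of_nat_mult distrib_left k double_theta_exp[OF assms]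
        mult.left_commute[of 2 "int m" "int (_ choose 2)"] double_choose_two
      by (simp add: algebra_simps)
    then have e: "m * (k choose 2) + a * k + m * N * (2*N - k) = c + theta_exp m a (int k - int N)"
      by (simp only: mult_cancel_left of_nat_eq_iff) simp
    have "(?X ^ m) ^ (k choose 2) * gauss_binomial (?X ^ m) (2*N) k * (?X ^ a) ^ k * ((?X ^ m) ^ N) ^ (2*N - k) =
        ?X ^ (m * (k choose 2) + a * k + m * N * (2*N - k)) * gauss_binomial (?X ^ m) (2*N) k"
      unfolding power_add power_mult by (simp only: mult_ac)
    then show "(?X ^ m) ^ (k choose 2) * gauss_binomial (?X ^ m) (2*N) k * (?X ^ a) ^ k * ((?X ^ m) ^ N) ^ (2*N - k) =
        ?X ^ c * (?X ^ theta_exp m a (int k - int N) * gauss_binomial (?X ^ m) (2*N) k)"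
      unfolding e power_add by (simp only: mult.assoc)
  qed
  finally show ?thesis
    by (simp flip: sum_distrib_left)
qed

text \<open>The Gaussian coefficient at distance i from the centre is accurate only to order m (N -
  i + 1), but its factor X^e has e at least m (i - 1), which makes up the loss.\<close>

lemma triple_product_agree:
  assumes "a \<le> m" "m \<ge> 1"
  shows "fps_agree (m * N) (qpoch a m N * qpoch (m - a) m N * qpoch m m N) (theta m a)"
proof -
  let ?e = "\<lambda>k. theta_exp m a (int k - int N)"
  have "fps_agree (m * N) (\<Sum>k\<le>2*N. fps_X ^ ?e k * (qpoch m m N * gauss_binomial (fps_X ^ m) (2*N) k))
      (\<Sum>k\<le>2*N. fps_X ^ ?e k * 1)"
  proof (rule fps_agree_sum)
    fix k assume "k \<in> {..2*N}"
    then have k: "k \<le> 2 * N" by simp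
    define i where "i = \<bar>int k - int N\<bar>"
    \<comment> \<open>No integer lies strictly between 1 and 2. This yields i (i - 1) / 2 at least i
      - 1.\<close>
    have "0 \<le> (i - 1) * (i - 2)"
      by (cases "i \<le> 1") (auto simp: mult_nonpos_nonpos)
    then have "0 \<le> int m * ((i - 1) * (i - 2))" by simp
    also have "\<dots> = int m * (i * (i - 1)) - 2 * (int m * (i - 1))"
      by (simp add: algebra_simps)
    finally have "int m * (i - 1) \<le> int (?e k)"
      using theta_exp_ge[OF assms(1), of "int k - int N"] by (simp add: i_def)
    moreover have "int (m * Suc (min k (2*N - k))) = int m * int N - int m * (i - 1)"
    proof -
      have "int (Suc (min k (2*N - k))) = int N - (i - 1)"
        using k by (auto simp: i_def min_def)
      then show ?thesis by (simp only: of_nat_mult right_diff_distrib)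
    qed
    ultimately have "int (m * N) \<le> int (?e k + m * Suc (min k (2*N - k)))"
      unfolding of_nat_add of_nat_mult by linarith
    then have "m * N \<le> ?e k + m * Suc (min k (2*N - k))"
      by (simp only: of_nat_le_iff)
    then show "fps_agree (m * N) (fps_X ^ ?e k * (qpoch m m N * gauss_binomial (fps_X ^ m) (2*N) k)) (fps_X ^ ?e k * 1)"
      using fps_agree_mono[OF fps_agree_X_power_mult[OF gauss_binomial_qpoch_agree[OF k assms(2)]]] by blast
  qed
  also have "(\<Sum>k\<le>2*N. fps_X ^ ?e k * (qpoch m m N * gauss_binomial (fps_X ^ m) (2*N) k)) =
      qpoch a m N * qpoch (m - a) m N * qpoch m m N"
    unfolding finite_triple_product[OF assms(1)] sum_distrib_right by (simp only: mult_ac)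
  also have "fps_agree (m * N) (\<Sum>k\<le>2*N. fps_X ^ ?e k * 1) (theta m a)"
    using theta_agree_sum[OF assms(1)] by simp
  finally show ?thesis .
qed

section \<open>Squaring in characteristic 2, trisection of products, and the theta quotient\<close>

lemma bit_fps_square_one_minus_X_power: "(1 - fps_X ^ k :: bit fps)\<^sup>2 = 1 - fps_X ^ (2 * k)"
proof -
  have "2 * fps_X ^ k = (0 :: bit fps)" 
    unfolding mult_2 bit_fps_minus[symmetric] by simp
  then have "(1 - fps_X ^ k :: bit fps)\<^sup>2 = 1 + (fps_X ^ k)\<^sup>2"
    by (simp add: bit_fps_minus power2_sum)
  then show ?thesis by (simp add: bit_fps_minus mult.commute[of 2] flip: power_mult)
qed

lemma qpoch_square: "(qpoch m m N)\<^sup>2 = qpoch (2 * m) (2 * m) N"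
proof -
  have "(qpoch m m N)\<^sup>2 = (\<Prod>k<N. (1 - fps_X ^ (m + m * k))\<^sup>2)"
    unfolding qpoch_def by (rule prod_power_distrib)
  then show ?thesis
    unfolding qpoch_def bit_fps_square_one_minus_X_power by (simp add: algebra_simps)
qed

text \<open>Sorting the factors by index modulo 3 gives the shape of a triple product with modulus
  \<open>3 * m\<close>; this leads to Euler's pentagonal number theorem.\<close>

lemma qpoch_trisect:
  "qpoch m m (3 * N) = qpoch m (3 * m) N * qpoch (3 * m - m) (3 * m) N * qpoch (3 * m) (3 * m) N"
proof (induction N)
  case (Suc N)
  have "3 * Suc N = Suc (Suc (Suc (3 * N)))" by simp
  then have "qpoch m m (3 * Suc N) = qpoch m m (3 * N) * (1 - fps_X ^ (m + m * (3 * N))) *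
      (1 - fps_X ^ (m + m * Suc (3 * N))) * (1 - fps_X ^ (m + m * Suc (Suc (3 * N))))"
    by (simp only: qpoch_Suc)
  also have "m + m * (3 * N) = m + 3 * m * N" by simp
  also have "m + m * Suc (3 * N) = 3 * m - m + 3 * m * N" by (simp add: algebra_simps)
  also have "m + m * Suc (Suc (3 * N)) = 3 * m + 3 * m * N" by (simp add: algebra_simps)
  finally show ?case
    unfolding Suc qpoch_Suc by (simp only: mult_ac)
qed (simp add: qpoch_def)

lemma cp_fps_times_theta:
  assumes "1 \<le> a" "a < m"
  shows "cp_fps a (m - a) m * theta m a = theta (6 * m) (2 * m)"
proof (rule fps_eqI_agree)
  fix N
  let ?F = "cp_fps a (m - a) m"
  have "fps_agree (m * N) (?F * theta m a) (?F * (qpoch a m N * qpoch (m - a) m N * qpoch m m N))"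
    using assms by (intro fps_agree_mult[OF fps_agree_refl fps_agree_sym[OF triple_product_agree]]) auto
  also have "?F * (qpoch a m N * qpoch (m - a) m N * qpoch m m N) =
      cp_fps (a + m * N) (m - a + m * N) m * (qpoch m m (2 * N) * qpoch m m N)"
    using cp_fps_times_qpoch_qpoch[OF assms, of N] by (simp only: mult.assoc[symmetric])
  \<comment> \<open>Both arguments of \<open>cp_fps\<close> now exceed \<open>m * N\<close>, so it
    counts as 1. Both products are lengthened to \<open>3 * N\<close> factors, so that they form a
    square and can be trisected.\<close>
  also have "fps_agree (m * N) \<dots> (1 * (qpoch m m (3 * N) * qpoch m m (3 * N)))"
  proof (intro fps_agree_mult)
    show "fps_agree (m * N) (cp_fps (a + m * N) (m - a + m * N) m) 1"
      unfolding fps_agree_def by (auto simp: cp_fps_nth cp_eq_of_bool)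
    show "fps_agree (m * N) (qpoch m m (2 * N)) (qpoch m m (3 * N))"
      by (rule fps_agree_sym, rule fps_agree_mono[OF qpoch_agree]) auto
    show "fps_agree (m * N) (qpoch m m N) (qpoch m m (3 * N))"
      by (rule fps_agree_sym, rule fps_agree_mono[OF qpoch_agree]) auto
  qed
  also have "1 * (qpoch m m (3 * N) * qpoch m m (3 * N)) =
      qpoch (2 * m) (6 * m) N * qpoch (6 * m - 2 * m) (6 * m) N * qpoch (6 * m) (6 * m) N"
    using qpoch_trisect[of "2 * m" N] qpoch_square[of m "3 * N"] by (simp add: power2_eq_square)
  also have "fps_agree (m * N) \<dots> (theta (6 * m) (2 * m))"
    using assms by (intro fps_agree_mono[OF triple_product_agree]) auto
  finally have "fps_agree (m * N) (?F * theta m a) (theta (6 * m) (2 * m))" .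
  then show "fps_agree N (?F * theta m a) (theta (6 * m) (2 * m))"
    by (rule fps_agree_mono) (use assms in auto)
qed

section \<open>Gaps between exponents\<close>

lemma theta_exp_diff:
  assumes "a \<le> m"
  shows "2 * (int (theta_exp m a j) - int (theta_exp m a k)) = (j - k) * (int m * (j + k - 1) + 2 * int a)"
  unfolding right_diff_distrib double_theta_exp[OF assms] by (simp add: algebra_simps)

text \<open>A zero would need m t = -2 a strictly between -2 m and 0, hence t = -1 and 2 a =
  m.\<close>

lemma theta_factor_nonzero:
  fixes t :: int
  assumes "1 \<le> a" "a < m" "2 * a \<noteq> m"
  shows "int m * t + 2 * int a \<noteq> 0"
proof
  assume *: "int m * t + 2 * int a = 0"
  have "t < 0"
  proof (rule ccontr)
    assume "\<not> t < 0"
    then have "0 \<le> int m * t" by simp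
    with * assms show False by simp
  qed
  moreover have "-2 < t"
  proof (rule ccontr)
    assume "\<not> -2 < t"
    then have "int m * t \<le> int m * (-2)" by (intro mult_left_mono) auto
    with * assms show False by simp
  qed
  ultimately have "t = -1" by simp
  with * assms show False by simp
qed

lemma inj_theta_exp:
  assumes "1 \<le> a" "a < m" "2 * a \<noteq> m"
  shows "inj (theta_exp m a)"
proof (rule injI)
  fix j k assume "theta_exp m a j = theta_exp m a k"
  then have "(j - k) * (int m * (j + k - 1) + 2 * int a) = 0"
    using theta_exp_diff[of a m j k] assms by simp
  then show "j = k"
    using theta_factor_nonzero[OF assms, of "j + k - 1"] by simp
qed

lemma theta_exp_gap:
  assumes "1 \<le> a" "a < m" "2 * a \<noteq> m" "j \<noteq> k" "L < \<bar>k\<bar>" "0 \<le> L"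
  shows "L - 1 \<le> 2 * \<bar>int (theta_exp m a j) - int (theta_exp m a k)\<bar>"
proof -
  \<comment> \<open>Since \<open>?t - (j - k) = 2 k - 1\<close>, one of the factors \<open>j - k\<close> and \<open>?t\<close> of the difference is large.\<close>
  let ?t = "j + k - 1"
  let ?f = "int m * ?t + 2 * int a"
  have f1: "1 \<le> \<bar>?f\<bar>" using theta_factor_nonzero[OF assms(1-3), of ?t] by linarith
  have jk: "1 \<le> \<bar>j - k\<bar>" using assms by linarith
  have "L - 1 \<le> \<bar>j - k\<bar> * \<bar>?f\<bar>"
  proof (cases "L \<le> \<bar>j - k\<bar>")
    case True
    have "L * 1 \<le> \<bar>j - k\<bar> * \<bar>?f\<bar>"
      using True f1 assms by (intro mult_mono) auto
    then show ?thesis by simp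
  next
    case False
    then have "L + 1 \<le> \<bar>?t\<bar>" using assms by linarith
    then have "int m * (L + 1) \<le> int m * \<bar>?t\<bar>" by (intro mult_left_mono) auto
    also have "\<dots> = \<bar>int m * ?t\<bar>" by (simp add: abs_mult)
    also have "\<dots> \<le> \<bar>?f\<bar> + 2 * int m" using assms by linarith
    finally have "int m * (L - 1) \<le> \<bar>?f\<bar>" by (simp add: algebra_simps)
    moreover have "L - 1 \<le> max 0 (int m * (L - 1))"
    proof (cases "L \<ge> 1")
      case True
      then have "1 * (L - 1) \<le> int m * (L - 1)" using assms by (intro mult_right_mono) auto
      then show ?thesis by simp
    qed simp
    ultimately have "L - 1 \<le> \<bar>?f\<bar>" using f1 by linarith
    also have "1 * \<bar>?f\<bar> \<le> \<bar>j - k\<bar> * \<bar>?f\<bar>" using jk by (intro mult_right_mono) auto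
    finally show ?thesis by simp
  qed
  also have "\<dots> = \<bar>2 * (int (theta_exp m a j) - int (theta_exp m a k))\<bar>"
    using assms by (subst theta_exp_diff) (auto simp: abs_mult)
  finally show ?thesis unfolding abs_mult by simp
qed

lemma theta_nth:
  assumes "1 \<le> a" "a < m" "2 * a \<noteq> m"
  shows "theta m a $ n = of_bool (n \<in> range (theta_exp m a))"
proof -
  have "{j. theta_exp m a j = n} = (if n \<in> range (theta_exp m a) then {inv (theta_exp m a) n} else {})"
    using inj_theta_exp[OF assms] by (auto simp: inv_f_f dest: injD)
  then show ?thesis by (simp add: theta_def)
qed

text \<open>The exponents become m j^2 / 2, so \<open>j\<close> and \<open>-j\<close> cancel modulo
  2 and only \<open>j = 0\<close> survives.\<close>

lemma theta_half:
  assumes "m \<ge> 1" "2 * a = m"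
  shows "theta m a = 1"
proof (rule fps_ext)
  fix n
  have e: "2 * int (theta_exp m a j) = int m * j\<^sup>2" for j
    using double_theta_exp[of a "2 * a" j] unfolding assms(2)[symmetric]
    by (simp add: algebra_simps power2_eq_square)
  have eq: "theta_exp m a j = theta_exp m a k \<longleftrightarrow> j = k \<or> j = -k" for j k
  proof -
    have "theta_exp m a j = theta_exp m a k \<longleftrightarrow> 2 * int (theta_exp m a j) = 2 * int (theta_exp m a k)"
      by simp
    also have "\<dots> \<longleftrightarrow> j\<^sup>2 = k\<^sup>2" unfolding e using assms(1) by simp
    finally show ?thesis by (simp add: power2_eq_iff)
  qed
  have e0: "theta_exp m a j = 0 \<longleftrightarrow> j = 0" for j
  proof -
    have "theta_exp m a j = 0 \<longleftrightarrow> 2 * int (theta_exp m a j) = 0" by simp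
    also have "\<dots> \<longleftrightarrow> j = 0" unfolding e using assms(1) by simp
    finally show ?thesis .
  qed
  show "theta m a $ n = 1 $ n"
  proof (cases "\<exists>k. theta_exp m a k = n")
    case True
    then obtain k where k: "theta_exp m a k = n" by blast
    then have "{j. theta_exp m a j = n} = {k, -k}" unfolding k[symmetric] eq by auto
    then have "theta m a $ n = of_nat (card {k, -k})"
      by (simp add: theta_def)
    also have "card {k, -k} = (if k = 0 then 1 else 2)"
      by simp
    finally show ?thesis using e0[of k] unfolding k by (cases "k = 0") simp_all
  next
    case False
    moreover have "n \<noteq> 0" using False e0[of 0] by metis
    ultimately show ?thesis by (simp add: theta_def)
  qed
qed

section \<open>Sparsity of doubled pentagonal numbers against finite multiples of theta\<close>

lemma pentagonal_theta_exp: "int (theta_exp (6 * m) (2 * m) j) = int m * (j * (3 * j - 1))"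
  using double_theta_exp[of "2 * m" "6 * m" j] by (simp add: algebra_simps)

text \<open>The difference factors as (j - k) (3 (j + k) - 1). Equal signs prevent cancellation in j
  + k, and integrality gives 5 |j| and 5 |k| at least 2 n + 1.\<close>

lemma pentagonal_gap:
  fixes j k n :: int
  assumes "j \<noteq> k" "2 * n < 5 * \<bar>j\<bar>" "2 * n < 5 * \<bar>k\<bar>" "j \<ge> 0 \<longleftrightarrow> k \<ge> 0"
  shows "12 * n + 1 \<le> 5 * \<bar>j * (3 * j - 1) - k * (3 * k - 1)\<bar>"
proof -
  let ?t = "3 * (j + k) - 1"
  from assms(4) consider "j \<ge> 0" "k \<ge> 0" | "j < 0" "k < 0" by linarith
  then have "3 * (\<bar>j\<bar> + \<bar>k\<bar>) - 1 \<le> \<bar>?t\<bar>" by cases auto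
  moreover have "2 * n + 1 \<le> 5 * \<bar>j\<bar>" "2 * n + 1 \<le> 5 * \<bar>k\<bar>" using assms(2,3) by auto
  ultimately have "12 * n + 1 \<le> 5 * \<bar>?t\<bar>" by (smt (verit))
  also have "\<bar>?t\<bar> \<le> \<bar>j - k\<bar> * \<bar>?t\<bar>"
    using assms(1) mult_right_mono[of 1 "\<bar>j - k\<bar>" "\<bar>?t\<bar>"] by simp
  also have "\<dots> = \<bar>j * (3 * j - 1) - k * (3 * k - 1)\<bar>"
    unfolding abs_mult[symmetric] by (simp add: algebra_simps)
  finally show ?thesis by simp
qed

text \<open>The leading term of \<open>G\<close> meets the exponent at \<open>k\<close>. Any other
  contribution needs a different theta exponent within distance \<open>d\<close>, which the gap
  bound excludes.\<close>

lemma finite_support_times_theta_nth: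
  fixes G :: "bit fps"
  assumes "1 \<le> a" "a < m" "2 * a \<noteq> m"
    and d: "G $ d = 1" "\<And>i. d < i \<Longrightarrow> G $ i = 0" and k: "2 * int d + 2 < \<bar>k\<bar>"
  shows "(G * theta m a) $ (theta_exp m a k + d) = 1"
proof -
  let ?e = "theta_exp m a k"
  have 0: "theta m a $ (?e + d - i) = 0" if "i < d" for i
  proof -
    have "?e + d - i \<notin> range (theta_exp m a)"
    proof
      assume "?e + d - i \<in> range (theta_exp m a)"
      then obtain j where j: "theta_exp m a j = ?e + d - i" by auto
      with that have "j \<noteq> k" by auto
      from theta_exp_gap[OF assms(1-3) this k] show False
        using j that by simp
    qed
    then show ?thesis by (simp add: theta_nth[OF assms(1-3)])
  qed
  have "(G * theta m a) $ (?e + d) = (\<Sum>i=0..?e + d. G $ i * theta m a $ (?e + d - i))"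
    by (rule fps_mult_nth)
  also have "\<dots> = (\<Sum>i\<in>{d}. G $ i * theta m a $ (?e + d - i))"
  proof (rule sum.mono_neutral_right)
    show "\<forall>i\<in>{0..?e + d} - {d}. G $ i * theta m a $ (?e + d - i) = 0"
    proof
      fix i assume "i \<in> {0..?e + d} - {d}"
      then consider "i < d" | "d < i" by fastforce
      then show "G $ i * theta m a $ (?e + d - i) = 0"
        by cases (simp_all add: 0 d(2))
    qed
  qed auto
  also have "\<dots> = 1"
    using d(1) by (simp add: theta_nth[OF assms(1-3)])
  finally show ?thesis .
qed

text \<open>The ratio 2/5 is chosen since 3 (2/5)^2 = 12/25 is below 1/2, so a smaller root could
  not reach m n (n - 1) / 2, while 6 (2/5) = 12/5 exceeds the 2 needed for the later gap
  argument.\<close>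

lemma root_large:
  fixes j n m e d :: int
  assumes "m \<ge> 2" "n \<ge> 100" "d \<ge> 0" "m * (n * (n - 1)) \<le> 2 * e" "e + d \<le> m * (j * (3 * j - 1)) + 1"
  shows "2 * n < 5 * \<bar>j\<bar>"
proof (rule ccontr)
  assume "\<not> 2 * n < 5 * \<bar>j\<bar>"
  then have j: "5 * \<bar>j\<bar> \<le> 2 * n" by simp
  define p where "p = j * (3 * j - 1)"
  have "m * (n * (n - 1)) \<le> 2 * (m * p) + 2" using assms(3-5) unfolding p_def[symmetric] by linarith
  also have "\<dots> \<le> m * (2 * p + 1)" using assms(1) by (simp add: algebra_simps)
  finally have p1: "n * (n - 1) \<le> 2 * p + 1" using assms(1) by simp
  have "(5 * \<bar>j\<bar>) * (5 * \<bar>j\<bar>) \<le> (2 * n) * (2 * n)"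
    by (rule mult_mono[OF j j]) (use assms in auto)
  then have "25 * (j * j) \<le> 4 * (n * n)" by simp
  moreover have "p = 3 * (j * j) - j" by (simp add: p_def algebra_simps)
  ultimately have "25 * p \<le> 12 * (n * n) + 10 * n" using j by linarith
  moreover have "n * n - n \<le> 2 * p + 1" using p1 by (simp add: algebra_simps)
  ultimately have "n * n \<le> 45 * n + 25" by linarith
  moreover have "100 * n \<le> n * n" using assms by (intro mult_right_mono) auto
  ultimately show False using assms by linarith
qed

text \<open>Three shifted theta exponents must lie at or just above pentagonal values. Two of the
  three roots share a sign, and their values are then too far apart. The offset 1 accommodates
  multiplication by 1 + X.\<close>

lemma finite_support_times_theta_not_pentagonal:
  fixes G :: "bit fps"
  assumes am: "1 \<le> a" "a < m" "2 * a \<noteq> m"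
    and fin: "finite {n. G $ n \<noteq> 0}" and "G \<noteq> 0"
    and pent: "\<And>n. (G * theta m a) $ n \<noteq> 0 \<Longrightarrow>
      \<exists>j::int. int n = int m * (j * (3 * j - 1)) \<or> int n = int m * (j * (3 * j - 1)) + 1"
  shows False
proof -
  define d where "d = Max {n. G $ n \<noteq> 0}"
  have "{n. G $ n \<noteq> 0} \<noteq> {}" using \<open>G \<noteq> 0\<close> by (auto simp: fps_eq_iff)
  from Max_in[OF fin this] have d1: "G $ d = 1" by (simp add: d_def)
  have d2: "G $ i = 0" if "d < i" for i
    using Max_ge[OF fin, of i] that by (fastforce simp: d_def)
  \<comment> \<open>Large enough both for isolating the leading term (more than
    \<open>2 * d + 2\<close>) and for \<open>root_large\<close> (at least 100).\<close>
  define n where "n = 2 * int d + 100"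
  let ?e = "\<lambda>k. int (theta_exp m a k)" and ?p = "\<lambda>j::int. j * (3 * j - 1)"
  have ex: "\<exists>j. ?e k + int d = int m * ?p j \<or> ?e k + int d = int m * ?p j + 1" if "n \<le> \<bar>k\<bar>" for k
    using pent[of "theta_exp m a k + d"] finite_support_times_theta_nth[OF am d1 d2, of k] that
    by (auto simp: n_def)
  obtain r where r: "?e k + int d = int m * ?p (r k) \<or> ?e k + int d = int m * ?p (r k) + 1"
    if "n \<le> \<bar>k\<bar>" for k
    using ex by metis
  have large: "2 * n < 5 * \<bar>r k\<bar>" if "n \<le> \<bar>k\<bar>" for k
  proof (rule root_large)
    have "n * (n - 1) \<le> \<bar>k\<bar> * (\<bar>k\<bar> - 1)"
      using that by (intro mult_mono) (auto simp: n_def)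
    then have "int m * (n * (n - 1)) \<le> int m * (\<bar>k\<bar> * (\<bar>k\<bar> - 1))"
      by (intro mult_left_mono) auto
    also have "\<dots> \<le> 2 * ?e k" using am by (intro theta_exp_ge) auto
    finally show "int m * (n * (n - 1)) \<le> 2 * ?e k" .
    show "?e k + int d \<le> int m * ?p (r k) + 1" using r[OF that] by linarith
  qed (use am in \<open>auto simp: n_def\<close>)
  have distinct: "r j \<noteq> r k" if "j \<noteq> k" "n \<le> \<bar>j\<bar>" "n \<le> \<bar>k\<bar>" for j k
  proof
    assume "r j = r k"
    with r[OF that(2)] r[OF that(3)] have "\<bar>?e j - ?e k\<bar> \<le> 1" by auto
    moreover have "n - 1 - 1 \<le> 2 * \<bar>?e j - ?e k\<bar>"
      using that by (intro theta_exp_gap[OF am]) (auto simp: n_def)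
    ultimately show False by (simp add: n_def)
  qed
  \<comment> \<open>Pentagonal indices of equal sign are about \<open>2.4 n\<close> apart in value, but the exponents at
    \<open>-n\<close>, \<open>n\<close>, \<open>n + 1\<close> spread over at most \<open>2 n + 1\<close> (in units of \<open>m\<close>).\<close>
  have opposite: "(r j \<ge> 0) \<noteq> (r k \<ge> 0)"
    if "j \<noteq> k" and nj: "n \<le> \<bar>j\<bar>" and nk: "n \<le> \<bar>k\<bar>" and spread: "\<bar>?e j - ?e k\<bar> \<le> int m * (2 * n + 1)" for j k
  proof
    assume "(r j \<ge> 0) = (r k \<ge> 0)"
    then have gap: "12 * n + 1 \<le> 5 * \<bar>?p (r j) - ?p (r k)\<bar>"
      by (intro pentagonal_gap large distinct that) auto
    have "int m * \<bar>?p (r j) - ?p (r k)\<bar> = \<bar>int m * ?p (r j) - int m * ?p (r k)\<bar>"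
      by (simp add: abs_mult flip: right_diff_distrib)
    also have "\<dots> \<le> \<bar>?e j - ?e k\<bar> + 1" using r[OF nj] r[OF nk] by linarith
    also have "\<dots> \<le> int m * (2 * n + 1) + int m" using spread am by linarith
    also have "\<dots> = int m * (2 * n + 2)" by (simp add: algebra_simps)
    finally have "\<bar>?p (r j) - ?p (r k)\<bar> \<le> 2 * n + 2" using am by simp
    with gap show False by (simp add: n_def)
  qed
  have n0: "n \<ge> 100" by (simp add: n_def)
  \<comment> \<open>The three differences are (2 a - m) n, m n + a and their sum a (2 n + 1); each
    is bounded by m (2 n + 1) since 0 < a < m.\<close>
  have s1: "?e n - ?e (-n) = (2 * int a - int m) * n"
    using theta_exp_diff[of a m n "-n"] am by (simp add: algebra_simps)
  have s2: "?e (n + 1) - ?e n = int m * n + int a"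
    using theta_exp_diff[of a m "n + 1" n] am by (simp add: algebra_simps)
  have am': "int a * n \<le> int m * n" "0 \<le> int a * n" "0 \<le> int m * n" "int a < int m"
    using am n0 by (auto intro!: mult_right_mono)
  have "\<bar>?e n - ?e (-n)\<bar> \<le> int m * (2 * n + 1)" "\<bar>?e (n + 1) - ?e n\<bar> \<le> int m * (2 * n + 1)"
    "\<bar>?e (n + 1) - ?e (-n)\<bar> \<le> int m * (2 * n + 1)"
    using s1 s2 am' unfolding distrib_left left_diff_distrib mult.assoc mult.left_commute[of _ 2] by linarith+
  \<comment> \<open>Three integers cannot have pairwise opposite signs.\<close>
  then show False
    using opposite[of n "-n"] opposite[of "n + 1" n] opposite[of "n + 1" "-n"] n0 by auto
qed

section \<open>Parities of the copartition numbers\<close>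

lemma of_nat_bit_eq_0_iff: "(of_nat n :: bit) = 0 \<longleftrightarrow> even n"
  by (cases "even n") (auto elim!: evenE oddE)

theorem theorem4p1:
  fixes a m :: nat
  assumes "1 \<le> a" and "a \<le> m - 1"
  shows "infinite {n. even (cp a (m - a) m n)} \<and> infinite {n. odd (cp a (m - a) m n)}"
proof -
  define F where "F = cp_fps a (m - a) m"
  define R where "R = theta (6 * m) (2 * m)"
  have am: "1 \<le> a" "a < m" using assms by auto
  have F: "even (cp a (m - a) m n) \<longleftrightarrow> F $ n = 0" for n
    by (simp add: F_def cp_fps_nth of_nat_bit_eq_0_iff)
  have FR: "F * theta m a = R"
    unfolding F_def R_def by (rule cp_fps_times_theta[OF am])
  have Rnth: "R $ n = of_bool (n \<in> range (theta_exp (6 * m) (2 * m)))" for n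
    unfolding R_def using am by (intro theta_nth) auto
  have R: "\<exists>j. int n = int m * (j * (3 * j - 1))" if "R $ n \<noteq> 0" for n
  proof -
    from that obtain j where "n = theta_exp (6 * m) (2 * m) j"
      unfolding Rnth by (auto split: if_splits)
    then show ?thesis using pentagonal_theta_exp by blast
  qed
  have R0: "R $ 0 = 1"
  proof -
    have "theta_exp (6 * m) (2 * m) 0 = 0" by (simp add: theta_exp_def)
    then have "0 \<in> range (theta_exp (6 * m) (2 * m))" by (rule range_eqI[OF sym])
    then show ?thesis unfolding Rnth by (simp only: of_bool_eq if_True)
  qed
  show ?thesis
  proof (cases "2 * a = m")
    case True
    then have FR: "F = R" using FR theta_half[of m a] am by simp
    have inf_odd: "infinite (range (theta_exp (6 * m) (2 * m)))"
      using am by (simp add: finite_image_iff inj_theta_exp infinite_UNIV_int)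
    have "{n. odd (cp a (m - a) m n)} = range (theta_exp (6 * m) (2 * m))"
      by (simp add: F FR Rnth)
    with inf_odd have odd: "infinite {n. odd (cp a (m - a) m n)}" by simp
    \<comment> \<open>All exponents in \<open>R\<close> are multiples of \<open>m\<close>, which is
      at least 2, so the residue class 1 modulo \<open>m\<close> gives even values only.\<close>
    have inf_even: "infinite (range (\<lambda>i. m * i + 1))"
      using am by (simp add: finite_image_iff inj_on_def)
    have "range (\<lambda>i. m * i + 1) \<subseteq> {n. even (cp a (m - a) m n)}"
    proof clarify
      fix i
      have "R $ (m * i + 1) = 0"
      proof (rule ccontr)
        assume "R $ (m * i + 1) \<noteq> 0"
        then obtain j where "int (m * i + 1) = int m * (j * (3 * j - 1))" using R by blast
        then have "1 = int m * (j * (3 * j - 1) - int i)" by (simp add: algebra_simps)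
        then have "int m dvd 1" by (metis dvd_triv_left)
        with am show False by simp
      qed
      then show "even (cp a (m - a) m (m * i + 1))" by (simp add: F FR)
    qed
    with inf_even have "infinite {n. even (cp a (m - a) m n)}" by (metis infinite_super)
    with odd show ?thesis by blast
  next
    case False
    have "infinite {n. F $ n \<noteq> 0}"
    proof
      assume "finite {n. F $ n \<noteq> 0}"
      then show False
      proof (rule finite_support_times_theta_not_pentagonal[OF am False])
        show "F \<noteq> 0" using R0 FR by auto
      qed (use R in \<open>unfold FR, blast\<close>)
    qed
    moreover have "infinite {n. F $ n = 0}"
    proof
      assume fin: "finite {n. F $ n = 0}"
      \<comment> \<open>If \<open>F\<close> is eventually 1, multiplying by 1 + X makes the support
        finite. On the right it turns \<open>R\<close> into \<open>R + X * R\<close>, whose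
        exponents are pentagonal values with offset 0 or 1.\<close>
      define G where "G = (1 + fps_X) * F"
      have G: "G $ n = F $ n + (if n = 0 then 0 else F $ (n - 1))" for n
        by (simp add: G_def distrib_right)
      \<comment> \<open>The index 0 is included because it has no predecessor to cancel
        against.\<close>
      define S where "S = insert 0 ({n. F $ n = 0} \<union> Suc ` {n. F $ n = 0})"
      have "G $ n = 0" if "n \<notin> S" for n
      proof -
        from that obtain k where "n = Suc k" "F $ n = 1" "F $ k = 1"
          by (cases n) (auto simp: S_def image_iff)
        then show ?thesis by (simp add: G)
      qed
      then have "{n. G $ n \<noteq> 0} \<subseteq> S" by blast
      moreover have "finite S" using fin by (simp add: S_def)
      ultimately have "finite {n. G $ n \<noteq> 0}" by (rule finite_subset)
      then show False
      proof (rule finite_support_times_theta_not_pentagonal[OF am False])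
        have GR: "(G * theta m a) $ n = R $ n + (if n = 0 then 0 else R $ (n - 1))" for n
          by (simp add: G_def mult.assoc FR distrib_right)
        show "G \<noteq> 0"
        proof
          assume "G = 0"
          with GR[of 0] R0 show False by simp
        qed
        fix n assume "(G * theta m a) $ n \<noteq> 0"
        then have "R $ n \<noteq> 0 \<or> n \<noteq> 0 \<and> R $ (n - 1) \<noteq> 0"
          unfolding GR by (cases "n = 0"; cases "R $ n = 0") simp_all
        then show "\<exists>j::int. int n = int m * (j * (3 * j - 1)) \<or> int n = int m * (j * (3 * j - 1)) + 1"
        proof
          assume "n \<noteq> 0 \<and> R $ (n - 1) \<noteq> 0"
          then obtain j where "int (n - 1) = int m * (j * (3 * j - 1))" "n \<noteq> 0" using R by blast
          then have "int n = int m * (j * (3 * j - 1)) + 1" by linarith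
          then show ?thesis by blast
        qed (use R in blast)
      qed
    qed
    ultimately show ?thesis by (simp add: F)
  qed
qed

end
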